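(* Let $N\ge2$, let $\tau\ge1$ be an integer, and let $A_1,\ldots,A_N\in\mathbb{R}^{n\times n}$. Suppose that the matrix sequences $R_i:\{0,\ldots,\tau\}\to\mathbb{S}^n$, $R_i(0)\succ0$, $i=1,\ldots,N$, and the scalar $\varepsilon>0$ satisfy $$A_i^{\prime}R_i(\tau)A_i-R_i(\tau)\prec0,\qquad A_i^\prime R_i(k+1)A_i-R_i(k)\preceq0,\qquad R_i(0)-R_j(\tau)+\varepsilon I\preceq0$$ for all $i,j=1,\ldots,N$, $i\ne j$ and $k=0,\ldots,\tau-1$. Then the first two families of inequalities are convex in the system matrices: for these fixed $R_i$, for every $i=1,\ldots,N$ and $k=0,\ldots,\tau-1$, the matrix-valued maps $$M\mapsto M^{\prime}R_i(\tau)M-R_i(\tau)\quad\text{and}\quad M\mapsto M^\prime R_i(k+1)M-R_i(k),\qquad M\in\mathbb{R}^{n\times n},$$ are convex with respect to the order $\preceq$ on $\mathbb{S}^n$.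
   Context: $\mathbb{S}^n$ denotes the set of real symmetric $n\times n$ matrices. For symmetric $A,B$, $A\succ B$ (resp. $A\succeq B$) means $A-B$ is positive definite (resp. positive semidefinite); $\prec,\preceq$ are the reversed relations. $A^\prime$ is the transpose of $A$. A map $f:\mathbb{R}^{n\times n}\to\mathbb{S}^n$ is convex with respect to $\preceq$ if $f(\lambda M_1+(1-\lambda)M_2)\preceq\lambda f(M_1)+(1-\lambda)f(M_2)$ for all $M_1,M_2$ and $\lambda\in[0,1]$. *)

theory Defs
  imports "HOL-Analysis.Analysis"
begin

definition symmetric_mat :: "real^'n^'n \<Rightarrow> bool" where
  "symmetric_mat P \<longleftrightarrow> transpose P = P"

text \<open>Definiteness includes symmetry, so that comparing two matrices never relies on the
  quadratic form of a non-symmetric difference.\<close>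

definition pos_semidef :: "real^'n^'n \<Rightarrow> bool" where
  "pos_semidef P \<longleftrightarrow> symmetric_mat P \<and> (\<forall>x. 0 \<le> x \<bullet> (P *v x))"

definition pos_def :: "real^'n^'n \<Rightarrow> bool" where
  "pos_def P \<longleftrightarrow> symmetric_mat P \<and> (\<forall>x. x \<noteq> 0 \<longrightarrow> 0 < x \<bullet> (P *v x))"

definition loewner_le :: "real^'n^'n \<Rightarrow> real^'n^'n \<Rightarrow> bool"  (infix "\<preceq>\<^sub>L" 50) where
  "P \<preceq>\<^sub>L Q \<longleftrightarrow> pos_semidef (Q - P)"

definition loewner_less :: "real^'n^'n \<Rightarrow> real^'n^'n \<Rightarrow> bool"  (infix "\<prec>\<^sub>L" 50) where
  "P \<prec>\<^sub>L Q \<longleftrightarrow> pos_def (Q - P)"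

text \<open>The first conjunct expresses that \<open>f\<close> takes values in the symmetric matrices.\<close>

definition loewner_convex :: "(real^'n^'n \<Rightarrow> real^'n^'n) \<Rightarrow> bool" where
  "loewner_convex f \<longleftrightarrow>
     (\<forall>M. symmetric_mat (f M)) \<and>
     (\<forall>M1 M2. \<forall>l\<in>{0..1}.
        f (l *\<^sub>R M1 + (1 - l) *\<^sub>R M2) \<preceq>\<^sub>L l *\<^sub>R f M1 + (1 - l) *\<^sub>R f M2)"

end

theory Submission
  imports Defs
begin

text \<open>
  For a positive semidefinite weight \<open>P\<close>, the map \<open>M \<mapsto> M' P M\<close> is convex for the same reason as
  a real quadratic: the gap between the chord and the map is again of the form \<open>D' P D\<close>, scaled by
  \<open>l (1 - l) \<ge> 0\<close>, with \<open>D = M1 - M2\<close> (\<open>loewner_convex_quadratic\<close>). Subtracting a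
  constant symmetric matrix changes nothing.

  It remains to see that every weight \<open>R i k\<close> that occurs is positive semidefinite, although
  positivity is only assumed at \<open>k = 0\<close>. Since \<open>N \<ge> 2\<close>, each mode \<open>i\<close> has a companion \<open>j \<noteq> i\<close>, and
  the coupling inequality puts \<open>R i \<tau>\<close> above \<open>R j 0 + \<epsilon> I\<close>, hence above zero. The decrease
  inequalities \<open>A' R (k + 1) A \<preceq> R k\<close> then carry positivity backwards from \<open>\<tau>\<close> to every smaller
  index (\<open>pos_semidef_backwards\<close>).
\<close>

lemma pos_semidef_add:
  assumes "pos_semidef P" and "pos_semidef Q"
  shows "pos_semidef (P + Q)"
  using assms
  by (auto simp: pos_semidef_def symmetric_mat_def transpose_def vec_eq_iff
      matrix_vector_mult_add_rdistrib inner_add_right)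

lemma pos_semidef_scaleR:
  assumes "0 \<le> c" and "pos_semidef P"
  shows "pos_semidef (c *\<^sub>R P)"
  using assms
  by (auto simp: pos_semidef_def symmetric_mat_def transpose_def vec_eq_iff
      scaleR_matrix_vector_assoc[symmetric])

lemma pos_semidef_mat_1: "pos_semidef (mat 1)"
  by (simp add: pos_semidef_def symmetric_mat_def transpose_mat)

lemma pos_def_imp_pos_semidef:
  assumes "pos_def P"
  shows "pos_semidef P"
  unfolding pos_semidef_def
proof (intro conjI allI)
  show "symmetric_mat P" using assms by (simp add: pos_def_def)
  fix x show "0 \<le> x \<bullet> (P *v x)"
    using assms by (cases "x = 0") (auto simp: pos_def_def less_imp_le)
qed

lemma symmetric_mat_congruence:
  fixes P :: "real^'n^'n" and M :: "real^'m^'n"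
  assumes "symmetric_mat P"
  shows "symmetric_mat (transpose M ** P ** M)"
  using assms by (simp add: symmetric_mat_def matrix_transpose_mul matrix_mul_assoc)

lemma inner_congruence:
  fixes P :: "real^'n^'n" and M :: "real^'m^'n"
  shows "x \<bullet> ((transpose M ** P ** M) *v x) = (M *v x) \<bullet> (P *v (M *v x))"
proof -
  have "x \<bullet> ((transpose M ** P ** M) *v x) = (P *v (M *v x) v* M) \<bullet> x"
    by (simp add: inner_commute del: vector_transpose_matrix flip: matrix_vector_mul_assoc)
  also have "\<dots> = (M *v x) \<bullet> (P *v (M *v x))"
    by (subst dot_lmul_matrix) (rule inner_commute)
  finally show ?thesis .
qed

lemma pos_semidef_congruence:
  fixes P :: "real^'n^'n" and M :: "real^'m^'n"
  assumes "pos_semidef P"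
  shows "pos_semidef (transpose M ** P ** M)"
  unfolding pos_semidef_def inner_congruence
  using assms by (simp add: pos_semidef_def symmetric_mat_congruence)

lemma pos_semidef_above:
  assumes "pos_semidef P" and "P \<preceq>\<^sub>L Q"
  shows "pos_semidef Q"
  using pos_semidef_add[OF assms(1), of "Q - P"] assms(2) by (simp add: loewner_le_def)

lemma loewner_le_0_diff: "P - Q \<preceq>\<^sub>L 0 \<longleftrightarrow> P \<preceq>\<^sub>L Q"
  by (simp add: loewner_le_def)

text \<open>The matrix form of \<open>l a\<^sup>2 + (1 - l) b\<^sup>2 - (l a + (1 - l) b)\<^sup>2 = l (1 - l) (a - b)\<^sup>2\<close>.
  The cross terms \<open>M1' P M2\<close> and \<open>M2' P M1\<close> both carry the coefficient \<open>- l (1 - l)\<close> on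
  either side, so they match one by one, and the identity already holds summand by summand in
  each matrix entry.\<close>

lemma quadratic_convexity_gap:
  fixes P M1 M2 :: "real^'n^'n"
  defines "q \<equiv> \<lambda>M. transpose M ** P ** M"
  shows "l *\<^sub>R q M1 + (1 - l) *\<^sub>R q M2 - q (l *\<^sub>R M1 + (1 - l) *\<^sub>R M2)
       = (l * (1 - l)) *\<^sub>R q (M1 - M2)"
proof -
  have q_entry: "q M $ a $ b = (\<Sum>k\<in>UNIV. \<Sum>h\<in>UNIV. M $ h $ a * P $ h $ k * M $ k $ b)" for M a b
    by (simp add: q_def matrix_matrix_mult_def transpose_def sum_distrib_right)
  show ?thesis
    by (simp add: vec_eq_iff q_entry sum_distrib_left flip: sum.distrib sum_subtractf)
       (intro allI sum.cong refl, simp add: algebra_simps)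
qed

lemma loewner_convex_quadratic:
  fixes P Q :: "real^'n^'n"
  assumes "pos_semidef P" and "symmetric_mat Q"
  shows "loewner_convex (\<lambda>M. transpose M ** P ** M - Q)"
  unfolding loewner_convex_def loewner_le_def
proof (intro conjI allI ballI)
  fix M :: "real^'n^'n"
  have "symmetric_mat (transpose M ** P ** M)"
    using assms(1) by (simp add: pos_semidef_def symmetric_mat_congruence)
  then show "symmetric_mat (transpose M ** P ** M - Q)"
    using assms(2) by (simp add: symmetric_mat_def transpose_def vec_eq_iff)
next
  fix M1 M2 :: "real^'n^'n" and l :: real
  assume l: "l \<in> {0..1}"
  define q where "q M = transpose M ** P ** M" for M :: "real^'n^'n"
  \<comment> \<open>The weights \<open>l\<close> and \<open>1 - l\<close> add up to one, so the constant \<open>Q\<close> cancels.\<close>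
  have "l *\<^sub>R (q M1 - Q) + (1 - l) *\<^sub>R (q M2 - Q) - (q (l *\<^sub>R M1 + (1 - l) *\<^sub>R M2) - Q)
      = l *\<^sub>R q M1 + (1 - l) *\<^sub>R q M2 - q (l *\<^sub>R M1 + (1 - l) *\<^sub>R M2)"
    by (simp add: algebra_simps)
  also have "\<dots> = (l * (1 - l)) *\<^sub>R q (M1 - M2)"
    unfolding q_def by (rule quadratic_convexity_gap)
  finally have gap: "l *\<^sub>R (q M1 - Q) + (1 - l) *\<^sub>R (q M2 - Q) - (q (l *\<^sub>R M1 + (1 - l) *\<^sub>R M2) - Q)
      = (l * (1 - l)) *\<^sub>R q (M1 - M2)" .
  have "pos_semidef ((l * (1 - l)) *\<^sub>R q (M1 - M2))"
    unfolding q_def using l assms(1) by (intro pos_semidef_scaleR pos_semidef_congruence) auto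
  then show "pos_semidef (l *\<^sub>R (transpose M1 ** P ** M1 - Q)
      + (1 - l) *\<^sub>R (transpose M2 ** P ** M2 - Q)
      - (transpose (l *\<^sub>R M1 + (1 - l) *\<^sub>R M2) ** P ** (l *\<^sub>R M1 + (1 - l) *\<^sub>R M2) - Q))"
    unfolding gap[unfolded q_def] q_def .
qed

text \<open>Positivity runs against the index: \<open>S k\<close> dominates a congruence transform of \<open>S (k + 1)\<close>,
  so only the last matrix of the sequence has to be checked.\<close>

lemma pos_semidef_backwards:
  fixes S :: "nat \<Rightarrow> real^'n^'n"
  assumes "pos_semidef (S t)"
    and "\<And>k. k < t \<Longrightarrow> transpose B ** S (k + 1) ** B \<preceq>\<^sub>L S k"
    and "k \<le> t"
  shows "pos_semidef (S k)"
  using \<open>k \<le> t\<close>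
proof (induction k rule: inc_induct)
  case base
  show ?case by (rule assms(1))
next
  case (step k)
  then have "pos_semidef (transpose B ** S (k + 1) ** B)"
    by (simp add: pos_semidef_congruence)
  then show ?case
    by (rule pos_semidef_above[OF _ assms(2)[OF step.hyps(2)]])
qed

theorem proposition3p2:
  fixes N \<tau> :: nat
    and A :: "nat \<Rightarrow> real^'n^'n"
    and R :: "nat \<Rightarrow> nat \<Rightarrow> real^'n^'n"
    and \<epsilon> :: real
  assumes "2 \<le> N" and "1 \<le> \<tau>" and "0 < \<epsilon>"
    and "\<And>i k. i \<in> {1..N} \<Longrightarrow> k \<in> {0..\<tau>} \<Longrightarrow> symmetric_mat (R i k)"
    and "\<And>i. i \<in> {1..N} \<Longrightarrow> 0 \<prec>\<^sub>L R i 0"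
    and "\<And>i. i \<in> {1..N} \<Longrightarrow> transpose (A i) ** R i \<tau> ** A i - R i \<tau> \<prec>\<^sub>L 0"
    and "\<And>i k. i \<in> {1..N} \<Longrightarrow> k \<in> {0..<\<tau>} \<Longrightarrow>
           transpose (A i) ** R i (k + 1) ** A i - R i k \<preceq>\<^sub>L 0"
    and "\<And>i j. i \<in> {1..N} \<Longrightarrow> j \<in> {1..N} \<Longrightarrow> i \<noteq> j \<Longrightarrow>
           R i 0 - R j \<tau> + \<epsilon> *\<^sub>R mat 1 \<preceq>\<^sub>L 0"
  shows "\<forall>i\<in>{1..N}. \<forall>k\<in>{0..<\<tau>}.
           loewner_convex (\<lambda>M. transpose M ** R i \<tau> ** M - R i \<tau>) \<and>
           loewner_convex (\<lambda>M. transpose M ** R i (k + 1) ** M - R i k)"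
proof -
  have psd_last: "pos_semidef (R i \<tau>)" if i: "i \<in> {1..N}" for i
  proof -
    obtain j where j: "j \<in> {1..N}" "j \<noteq> i"
    proof (cases "i = 1")
      case True
      then show ?thesis using that[of 2] \<open>2 \<le> N\<close> by simp
    next
      case False
      then show ?thesis using that[of 1] \<open>2 \<le> N\<close> by simp
    qed
    have "pos_semidef (R j 0)"
      using assms(5)[OF j(1)] by (simp add: loewner_less_def pos_def_imp_pos_semidef)
    moreover have "pos_semidef (\<epsilon> *\<^sub>R mat 1 :: real^'n^'n)"
      using \<open>0 < \<epsilon>\<close> by (simp add: pos_semidef_scaleR pos_semidef_mat_1)
    ultimately have "pos_semidef (R j 0 + \<epsilon> *\<^sub>R mat 1)"
      by (rule pos_semidef_add)
    moreover have "R j 0 + \<epsilon> *\<^sub>R mat 1 \<preceq>\<^sub>L R i \<tau>"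
      using assms(8)[OF j(1) i j(2)] by (simp add: loewner_le_def algebra_simps)
    ultimately show ?thesis by (rule pos_semidef_above)
  qed
  have psd: "pos_semidef (R i k)" if i: "i \<in> {1..N}" and k: "k \<le> \<tau>" for i k
  proof (rule pos_semidef_backwards[where S = "R i", OF psd_last[OF i] _ k])
    show "transpose (A i) ** R i (h + 1) ** A i \<preceq>\<^sub>L R i h" if "h < \<tau>" for h
      using assms(7)[OF i, of h] that by (simp add: loewner_le_0_diff)
  qed
  show ?thesis
    using assms(4) by (auto intro!: loewner_convex_quadratic psd)
qed

end
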